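(* Let $\lambda>0$ and $a,b,c\in\mathbb{R}$, and let $(X_n)_{n\ge0}$ be the Markov chain on $\mathbb{N}^3$ associated with the discrete-time Hawkes process with memory $3$ and parameters $a,b,c,\lambda$. If $a,b,c$ satisfy one of the following conditions: (1) $a<0$, $b<0$ and $c>1$, or (2) $b>1$ and $ab+c<0$, then the Markov chain $(X_n)_{n\ge0}$ is transient.
   Context: $\mathbb{N}=\{0,1,2,\dots\}$ and $(x)_+=\max(0,x)$. $\mathcal{P}(\rho)$ denotes the Poisson distribution with parameter $\rho\ge 0$ (with $\mathcal{P}(0)$ the Dirac mass at $0$). The discrete-time Hawkes process with memory $3$ and parameters $a,b,c\in\mathbb{R}$, $\lambda>0$ is the $\mathbb{N}$-valued process $(\tilde X_n)_{n\ge -2}$ such that, for all $n\ge 1$, conditionally on the past, $\tilde X_n\sim\mathcal{P}\big((a\tilde X_{n-1}+b\tilde X_{n-2}+c\tilde X_{n-3}+\lambda)_+\big)$. The associated Markov chain is $X_n=(\tilde X_n,\tilde X_{n-1},\tilde X_{n-2})\in\mathbb{N}^3$. Its transition probability from $(i,j,k)$ to $(\ell,i,j)$ is $e^{-s_{ijk}}s_{ijk}^{\ell}/\ell!$ for $\ell\in\mathbb{N}$, where $s_{ijk}=(ai+bj+ck+\lambda)_+$ (with the convention $0^0=1$); all other transition probabilities are $0$. The state $(0,0,0)$ is accessible from every state, and the chain is called transient if this accessible state is transient, i.e. $\mathbb{P}_{(0,0,0)}(X_n\ne(0,0,0)\text{ for all }n\ge1)>0$. *)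

theory Defs
  imports "HOL-Probability.Probability"
begin

text \<open>
  One-step kernels in the form required by the Ionescu-Tulcea theorem: given the first \<open>n\<close>
  coordinates of a path, the law of coordinate \<open>n\<close>. Coordinate 0 is the deterministic start.
\<close>

definition chain_step :: "('s \<Rightarrow> 's pmf) \<Rightarrow> 's \<Rightarrow> nat \<Rightarrow> (nat \<Rightarrow> 's) \<Rightarrow> 's measure" where
  "chain_step K x n \<omega> =
     measure_pmf (case n of 0 \<Rightarrow> return_pmf x | Suc m \<Rightarrow> K (\<omega> m))"

text \<open>
  The law \<open>\<P>\<^sub>x\<close> of the chain started at \<open>x\<close>, on the path space with the product of the discrete
  sigma-algebras; under it the chain is the coordinate process. The finite-dimensional
  distributions are given in \<open>chain_law_cylinder\<close> below.
\<close>

definition chain_law :: "('s \<Rightarrow> 's pmf) \<Rightarrow> 's \<Rightarrow> (nat \<Rightarrow> 's) measure" where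
  "chain_law K x =
     projective_family.lim UNIV
       (Ionescu_Tulcea.CI (chain_step K x) (\<lambda>_. count_space UNIV)) (\<lambda>_. count_space UNIV)"

definition transient_state :: "('s \<Rightarrow> 's pmf) \<Rightarrow> 's \<Rightarrow> bool" where
  "transient_state K x \<longleftrightarrow>
     measure (chain_law K x) {\<omega> \<in> space (chain_law K x). \<forall>n\<ge>1. \<omega> n \<noteq> x} > 0"

lemma Ionescu_Tulcea_chain_step:
  "Ionescu_Tulcea (chain_step K x) (\<lambda>_. count_space UNIV)"
proof (unfold Ionescu_Tulcea_def, intro conjI allI impI, goal_cases)
  case (1 i)
  show ?case
  proof (cases i)
    case 0
    then show ?thesis
      by (simp add: chain_step_def[abs_def] measure_pmf_in_subprob_algebra)
  next
    case (Suc m)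
    have "(\<lambda>\<omega>. \<omega> m) \<in> measurable (PiM {0..<i} (\<lambda>_. count_space UNIV)) (count_space UNIV)"
      by (rule measurable_component_singleton) (simp add: Suc)
    from measurable_compose[OF this measurable_measure_pmf[of K]] show ?thesis
      by (simp add: chain_step_def[abs_def] Suc)
  qed
next
  case (2 i \<omega>)
  show ?case
    by (simp add: chain_step_def measure_pmf.prob_space_axioms)
qed

lemma sets_chain_law: "sets (chain_law K x) = sets (PiM UNIV (\<lambda>_. count_space UNIV))"
proof -
  interpret Ionescu_Tulcea "chain_step K x" "\<lambda>_. count_space UNIV"
    by (rule Ionescu_Tulcea_chain_step)
  show ?thesis by (simp add: chain_law_def)
qed

lemma space_chain_law: "space (chain_law K x) = UNIV"
  using sets_eq_imp_space_eq[OF sets_chain_law[of K x]] by (simp add: space_PiM)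

lemma prob_space_chain_law: "prob_space (chain_law K x)"
proof -
  interpret Ionescu_Tulcea "chain_step K x" "\<lambda>_. count_space UNIV"
    by (rule Ionescu_Tulcea_chain_step)
  show ?thesis
  proof
    have "emeasure PF.lim (PF.emb UNIV {} {\<lambda>_. undefined}) = emeasure (CI {}) {\<lambda>_. undefined}"
      by (rule lim) (auto simp: sets_PiM_empty)
    moreover have "PF.emb UNIV {} {\<lambda>_. undefined} = UNIV"
      by (auto simp: prod_emb_def space_PiM)
    moreover have "emeasure (CI {}) {\<lambda>_. undefined} = 1"
      using prob_space.emeasure_space_1[OF PF.prob_space_P[of "{}"]]
      by (simp add: PF.space_P space_PiM)
    ultimately show "emeasure (chain_law K x) (space (chain_law K x)) = 1"
      unfolding space_chain_law by (simp add: chain_law_def)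
  qed
qed

lemma chain_law_cylinder:
  "measure (chain_law K x) {\<omega>. \<forall>i\<le>n. \<omega> i = y i} =
     (if y 0 = x then (\<Prod>i<n. pmf (K (y i)) (y (Suc i))) else 0)"
proof -
  interpret Ionescu_Tulcea "chain_step K x" "\<lambda>_. count_space UNIV"
    by (rule Ionescu_Tulcea_chain_step)
  let ?M = "\<lambda>_::nat. count_space (UNIV :: 'a set)"
  let ?r = "\<lambda>n. restrict y {0..<n}"
  have set1: "{?r n} \<in> sets (PiM {0..<n} ?M)" for n
  proof -
    have "{?r n} = PiE {0..<n} (\<lambda>i. {y i})"
      by (auto simp: PiE_def Pi_def extensional_def fun_eq_iff restrict_def)
    also have "\<dots> \<in> sets (PiM {0..<n} ?M)"
      by (rule sets_PiM_I_finite) auto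
    finally show ?thesis .
  qed
  have sp: "?r n \<in> space (PiM {0..<n} ?M)" for n
    by (auto simp: space_PiM)
  have und: "(\<lambda>_. undefined) \<in> space (PiM {0..<0} ?M)"
    by (auto simp: space_PiM)
  have step: "emeasure (C 0 (Suc n) (\<lambda>_. undefined)) {?r (Suc n)} =
      emeasure (C 0 n (\<lambda>_. undefined)) {?r n} *
      emeasure (chain_step K x n (?r n)) {y n}" for n
  proof -
    have "emeasure (C 0 (Suc n) (\<lambda>_. undefined)) {?r (Suc n)} =
        (\<integral>\<^sup>+\<omega>. emeasure (eP n \<omega>) {?r (Suc n)} \<partial>C 0 n (\<lambda>_. undefined))"
    proof -
      have me: "eP n \<in> measurable (C 0 n (\<lambda>_. undefined)) (subprob_algebra (PiM {0..<Suc n} ?M))"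
        using measurable_eP[of n] sets_C[OF und, of n] by (simp cong: measurable_cong_sets)
      show ?thesis
        using space_C[OF und, of n] set1[of "Suc n"] und
        by (subst C.simps, subst emeasure_bind[OF _ _ set1])
           (use me in auto)
    qed
    also have "\<dots> = (\<integral>\<^sup>+\<omega>. emeasure (chain_step K x n (?r n)) {y n} *
        indicator {?r n} \<omega> \<partial>C 0 n (\<lambda>_. undefined))"
    proof (rule nn_integral_cong)
      fix \<omega> assume "\<omega> \<in> space (C 0 n (\<lambda>_. undefined))"
      then have \<omega>: "\<omega> \<in> space (PiM {0..<n} ?M)"
        using space_C[OF und, of n] by simp
      then have ext: "\<omega> \<in> extensional {0..<n}"
        by (auto simp: space_PiM PiE_def)
      have "(fun_upd \<omega> n z = ?r (Suc n)) \<longleftrightarrow> \<omega> = ?r n \<and> z = y n" for z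
      proof
        assume eq: "fun_upd \<omega> n z = ?r (Suc n)"
        have "\<omega> i = ?r n i" for i
          using fun_cong[OF eq, of i] ext by (cases "i < n") (auto simp: extensional_def)
        moreover have "z = y n"
          using fun_cong[OF eq, of n] by simp
        ultimately show "\<omega> = ?r n \<and> z = y n" by auto
      qed (auto simp: fun_eq_iff)
      then have "(\<lambda>z. fun_upd \<omega> n z) -` {?r (Suc n)} \<inter> space (?M n) =
          (if \<omega> = ?r n then {y n} else {})"
        by auto
      then show "emeasure (eP n \<omega>) {?r (Suc n)} =
          emeasure (chain_step K x n (?r n)) {y n} * indicator {?r n} \<omega>"
        using emeasure_eP[OF \<omega> set1[of "Suc n"]] by (auto simp: indicator_def)
    qed
    also have "\<dots> = emeasure (chain_step K x n (?r n)) {y n} *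
        emeasure (C 0 n (\<lambda>_. undefined)) {?r n}"
      using set1[of n] sets_C[OF und, of n] by (subst nn_integral_cmult_indicator) auto
    finally show ?thesis by (simp add: mult.commute)
  qed
  have fin: "emeasure (C 0 (Suc n) (\<lambda>_. undefined)) {?r (Suc n)} =
      ennreal (if y 0 = x then (\<Prod>i<n. pmf (K (y i)) (y (Suc i))) else 0)" for n
  proof (induction n)
    case 0
    have "emeasure (C 0 0 (\<lambda>_. undefined)) {?r 0} = 1"
      using set1[of 0] by (simp add: restrict_def)
    then show ?case
      unfolding step by (simp add: chain_step_def emeasure_pmf_single pmf_return)
  next
    case (Suc n)
    have "emeasure (chain_step K x (Suc n) (?r (Suc n))) {y (Suc n)} =
        ennreal (pmf (K (y n)) (y (Suc n)))"
      by (simp add: chain_step_def emeasure_pmf_single)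
    then show ?case
      unfolding step[of "Suc n"] Suc
      by (simp add: ennreal_mult'' [symmetric])
  qed
  have emb: "PF.emb UNIV {0..<Suc n} {?r (Suc n)} = {\<omega>. \<forall>i\<le>n. \<omega> i = y i}"
    by (auto simp: prod_emb_def space_PiM fun_eq_iff restrict_def less_Suc_eq_le) metis
  have "emeasure (chain_law K x) {\<omega>. \<forall>i\<le>n. \<omega> i = y i} = emeasure (CI {0..<Suc n}) {?r (Suc n)}"
    unfolding emb[symmetric] chain_law_def by (rule lim) (auto intro: set1)
  also have "\<dots> = emeasure (C 0 (Suc n) (\<lambda>_. undefined)) {?r (Suc n)}"
    using emeasure_CI[OF order_refl set1[of "Suc n"]]
    by (subst (asm) prod_emb_id) (auto simp: space_PiM)
  finally show ?thesis
    using fin[of n] by (simp add: measure_def prod_nonneg)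
qed


text \<open>The library's \<^const>\<open>poisson_pmf\<close> is specified for positive rates only.\<close>

definition poisson_law :: "real \<Rightarrow> nat pmf" where
  "poisson_law s = (if s = 0 then return_pmf 0 else poisson_pmf s)"

definition hawkes_rate :: "real \<Rightarrow> real \<Rightarrow> real \<Rightarrow> real \<Rightarrow> nat \<times> nat \<times> nat \<Rightarrow> real" where
  "hawkes_rate a b c lam = (\<lambda>(i, j, k). max 0 (a * real i + b * real j + c * real k + lam))"

definition hawkes_kernel ::
  "real \<Rightarrow> real \<Rightarrow> real \<Rightarrow> real \<Rightarrow> nat \<times> nat \<times> nat \<Rightarrow> (nat \<times> nat \<times> nat) pmf" where
  "hawkes_kernel a b c lam =
     (\<lambda>(i, j, k). map_pmf (\<lambda>l. (l, i, j)) (poisson_law (hawkes_rate a b c lam (i, j, k))))"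

text \<open>
  The state \<open>(0, 0, 0)\<close> is accessible from every state (\<open>hawkes_accessible_zero\<close>
  below), and transience of the chain
  means transience of this state.
\<close>

definition hawkes_transient :: "real \<Rightarrow> real \<Rightarrow> real \<Rightarrow> real \<Rightarrow> bool" where
  "hawkes_transient a b c lam \<longleftrightarrow> transient_state (hawkes_kernel a b c lam) (0, 0, 0)"

lemma pmf_poisson_law:
  assumes "s \<ge> 0"
  shows "pmf (poisson_law s) l = exp (- s) * s ^ l / fact l"
  using assms by (cases l) (auto simp: poisson_law_def pmf_return)

lemma pmf_hawkes_kernel:
  "pmf (hawkes_kernel a b c lam (i, j, k)) (l, i', j') =
     (let s = max 0 (a * real i + b * real j + c * real k + lam)
      in if i' = i \<and> j' = j then exp (- s) * s ^ l / fact l else 0)"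
proof (cases "i' = i \<and> j' = j")
  case True
  have inj: "inj (\<lambda>l::nat. (l, i, j))"
    by (auto simp: inj_on_def)
  show ?thesis
    using pmf_map_inj'[OF inj, of "poisson_law (hawkes_rate a b c lam (i, j, k))" l] True
    by (simp add: hawkes_kernel_def hawkes_rate_def pmf_poisson_law Let_def)
next
  case False
  then show ?thesis
    by (auto simp: hawkes_kernel_def pmf_eq_0_set_pmf Let_def)
qed

lemma hawkes_accessible_zero:
  "(x, (0, 0, 0)) \<in> {(x, y). y \<in> set_pmf (hawkes_kernel a b c lam x)}\<^sup>*"
proof -
  let ?R = "{(x, y). y \<in> set_pmf (hawkes_kernel a b c lam x)}"
  have step: "((i, j, k), (0, i, j)) \<in> ?R" for i j k
    by (simp add: set_pmf_iff pmf_hawkes_kernel Let_def)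
  obtain i j k where "x = (i, j, k)"
    by (cases x)
  with step[of i j k] step[of 0 i j] step[of 0 0 i] show ?thesis
    by (meson rtrancl.rtrancl_refl rtrancl.rtrancl_into_rtrancl)
qed

end

theory Submission
  imports Defs
begin

text \<open>Transience follows from a function f with values in [0, 1] that is zero at the origin,
  positive at some state reachable from it, and at most its own mean after one step: f then bounds
  from below the chance of never visiting the origin
  (\<open>transient_state_if_bounded_submartingale\<close>). Far out, the chain can follow a cycle
  whose only random step multiplies the large entry i by about c > 1 or b > 1; in the other steps
  the truncated rate is 0. On this cycle f is 1 - C/(i + 1), cut off at 0. As E[1/(L + 1)] \<le> 1/s
  for L Poisson of rate s, the random step gains at least C/(i + 1) - C/s. In
  \<open>hawkes_transient_neg_neg\<close> the cycle cannot break at large entries, so s \<ge> i + 1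
  suffices. In \<open>hawkes_transient_alternating\<close> it breaks with probability O(1/i) by
  Chebyshev's inequality; the gain is of order C/i, so a large C pays for the loss.\<close>

section \<open>Poisson moments\<close>

lemma has_bochner_integral_pmf_nat_sums:
  fixes p :: "nat pmf" and f :: "nat \<Rightarrow> real"
  assumes "\<And>n. 0 \<le> f n" and "(\<lambda>n. pmf p n * f n) sums S"
  shows "has_bochner_integral (measure_pmf p) f S"
proof -
  have int: "integrable (count_space UNIV) (\<lambda>n. pmf p n * f n)"
    unfolding integrable_count_space_nat_iff
    using assms by (auto simp: abs_mult dest: sums_summable)
  then have "has_bochner_integral (count_space UNIV) (\<lambda>n. pmf p n * f n) S"
    using integral_count_space_nat[OF int] assms(2)
    by (simp add: has_bochner_integral_iff sums_iff)
  then show ?thesis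
    unfolding measure_pmf_eq_density by (intro has_bochner_integral_density) auto
qed

text \<open>Dividing the Poisson weight at n by n + 1 gives the weight at n + 1 divided by s, so the
  sum is the mass off 0 divided by s.\<close>

lemma poisson_pmf_inverse_Suc_sums:
  assumes "s > 0"
  shows "(\<lambda>n. pmf (poisson_pmf s) n * (1 / (real n + 1))) sums ((1 - exp (- s)) / s)"
proof -
  have "(\<lambda>n. s ^ n / fact n) sums exp s"
    using exp_converges[of s] by (simp add: divide_inverse mult.commute)
  then have "(\<lambda>n. s ^ Suc n / fact (Suc n)) sums (exp s - 1)"
    by (subst sums_Suc_iff) simp
  then have "(\<lambda>n. s ^ Suc n / fact (Suc n) * (exp (- s) / s)) sums ((exp s - 1) * (exp (- s) / s))"
    by (rule sums_mult2)
  moreover have "s ^ Suc n / fact (Suc n) * (exp (- s) / s) =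
      pmf (poisson_pmf s) n * (1 / (real n + 1))" for n
    using assms by (simp add: field_simps)
  moreover have "(exp s - 1) * (exp (- s) / s) = (1 - exp (- s)) / s"
    by (simp add: field_simps exp_minus)
  ultimately show ?thesis by (simp only:)
qed

lemma poisson_pmf_variance_sums:
  assumes "s > 0"
  shows "(\<lambda>n. pmf (poisson_pmf s) n * (real n - s)\<^sup>2) sums s"
proof -
  define p where "p n = pmf (poisson_pmf s) n" for n
  have p_Suc: "p (Suc n) * real (Suc n) = s * p n" for n
    using assms by (simp add: p_def fact_Suc del: of_nat_Suc)
  have "(\<lambda>n. s ^ n / fact n) sums exp s"
    using exp_converges[of s] by (simp add: divide_inverse mult.commute)
  from sums_mult2[OF this, of "exp (- s)"] have m0: "p sums 1"
    using assms by (simp add: p_def[abs_def] exp_minus)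
  have "(\<lambda>n. p (Suc n) * real (Suc n)) sums (s * 1)"
    unfolding p_Suc by (rule sums_mult[OF m0])
  then have m1: "(\<lambda>n. p n * real n) sums s"
    by (subst (asm) sums_Suc_iff) simp
  have "(\<lambda>n. s * (p n * real n + p n)) sums (s * (s + 1))"
    by (intro sums_mult sums_add m0 m1)
  moreover have "s * (p n * real n + p n) = p (Suc n) * (real (Suc n))\<^sup>2" for n
    using p_Suc[of n] by (simp add: power2_eq_square mult.assoc[symmetric]) (simp add: algebra_simps)
  ultimately have "(\<lambda>n. p (Suc n) * (real (Suc n))\<^sup>2) sums (s * (s + 1))"
    by simp
  then have m2: "(\<lambda>n. p n * (real n)\<^sup>2) sums (s * (s + 1))"
    by (subst (asm) sums_Suc_iff) simp
  have "(\<lambda>n. p n * (real n)\<^sup>2 - 2 * s * (p n * real n) + s\<^sup>2 * p n) sums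
      (s * (s + 1) - 2 * s * s + s\<^sup>2 * 1)"
    by (intro sums_add sums_diff sums_mult m0 m1 m2)
  then show ?thesis
    by (simp add: p_def algebra_simps power2_eq_square)
qed

text \<open>Integrate the pointwise bound. The quadratic term is the pointwise form of Chebyshev's
  inequality: it pays for those n, far from the mean s, at which F drops below 1 - C/(n +
  1).\<close>

lemma poisson_pmf_expectation_ge:
  fixes F :: "nat \<Rightarrow> real"
  assumes "s > 0" "C \<ge> 0" "q \<ge> 0"
    and F01: "\<And>n. 0 \<le> F n" "\<And>n. F n \<le> 1"
    and F: "\<And>n. F n \<ge> 1 - C / (real n + 1) - q * (real n - s)\<^sup>2"
  shows "measure_pmf.expectation (poisson_pmf s) F \<ge> 1 - C / s - q * s"
proof -
  let ?p = "poisson_pmf s"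
  let ?G = "\<lambda>n. 1 - C * (1 / (real n + 1)) - q * (real n - s)\<^sup>2"
  have "has_bochner_integral ?p (\<lambda>n. 1 / (real n + 1)) ((1 - exp (- s)) / s)"
    by (rule has_bochner_integral_pmf_nat_sums[OF _ poisson_pmf_inverse_Suc_sums[OF \<open>s > 0\<close>]]) simp
  moreover have "has_bochner_integral ?p (\<lambda>n. (real n - s)\<^sup>2) s"
    by (rule has_bochner_integral_pmf_nat_sums[OF _ poisson_pmf_variance_sums[OF \<open>s > 0\<close>]]) simp
  moreover have "has_bochner_integral ?p (\<lambda>n. 1 :: real) 1"
    by (simp add: has_bochner_integral_iff)
  ultimately have "has_bochner_integral ?p ?G (1 - C * ((1 - exp (- s)) / s) - q * s)"
    by (intro has_bochner_integral_diff has_bochner_integral_mult_right)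
  then have iG: "integrable ?p ?G"
    and "measure_pmf.expectation ?p ?G = 1 - C * ((1 - exp (- s)) / s) - q * s"
    by (simp_all only: has_bochner_integral_iff)
  moreover have "C * ((1 - exp (- s)) / s) \<le> C / s"
    using assms by (simp add: field_simps)
  moreover have "measure_pmf.expectation ?p ?G \<le> measure_pmf.expectation ?p F"
  proof (rule integral_mono[OF iG])
    show "integrable ?p F"
      using F01 by (intro measure_pmf.integrable_const_bound[where B = 1]) auto
  qed (use F in simp)
  ultimately show ?thesis by linarith
qed

section \<open>Transience from a bounded submartingale\<close>

text \<open>
  \<open>f (\<omega> n)\<close> stopped at the first visit to \<open>x\<close> is a submartingale with values in \<open>[0, 1]\<close> that
  vanishes once \<open>x\<close> is hit, so \<open>f z\<close> bounds the probability of never visiting \<open>x\<close> from \<open>z\<close>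
  from below.
\<close>

lemma emeasure_chain_law_avoid_ge:
  fixes K :: "'s :: countable \<Rightarrow> 's pmf" and f :: "'s \<Rightarrow> real"
  assumes f01: "\<And>z. 0 \<le> f z" "\<And>z. f z \<le> 1" and fx: "f x = 0"
    and sub: "\<And>z. f z \<le> measure_pmf.expectation (K z) f"
  shows "emeasure (chain_law K x0) {\<omega>. \<forall>i\<le>m. \<omega> i = y i} * ennreal (f (y m)) \<le>
    emeasure (chain_law K x0) {\<omega>. (\<forall>i\<le>m. \<omega> i = y i) \<and> (\<forall>i. m < i \<and> i \<le> m + n \<longrightarrow> \<omega> i \<noteq> x)}"
\<comment> \<open>First-step analysis: the induction hypothesis is applied to the path prolonged by
  each possible next state z, hence the arbitrary \<open>m\<close> and \<open>y\<close>.\<close>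
proof (induction n arbitrary: m y)
  case 0
  have "emeasure (chain_law K x0) {\<omega>. \<forall>i\<le>m. \<omega> i = y i} * ennreal (f (y m)) \<le>
      emeasure (chain_law K x0) {\<omega>. \<forall>i\<le>m. \<omega> i = y i} * 1"
    using f01 by (intro mult_left_mono) auto
  moreover have "{\<omega>. (\<forall>i\<le>m. \<omega> i = y i) \<and> (\<forall>i. m < i \<and> i \<le> m + 0 \<longrightarrow> \<omega> i \<noteq> x)} =
      {\<omega>. \<forall>i\<le>m. \<omega> i = y i}"
    by auto
  ultimately show ?case by (simp only: mult_1_right)
next
  case (Suc n)
  interpret prob_space "chain_law K x0" by (rule prob_space_chain_law)
  let ?P = "emeasure (chain_law K x0)"
  let ?c = "\<lambda>m y. {\<omega>. \<forall>i\<le>m. \<omega> i = y i}"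
  let ?A = "\<lambda>m y n. {\<omega>. (\<forall>i\<le>m. \<omega> i = y i) \<and> (\<forall>i. m < i \<and> i \<le> m + n \<longrightarrow> \<omega> i \<noteq> x)}"
  have meas [measurable]: "(\<lambda>\<omega>. \<omega> i) \<in> measurable (chain_law K x0) (count_space UNIV)" for i
    by (subst measurable_cong_sets[OF sets_chain_law refl]) simp
  have sets_A: "?A m y n \<in> sets (chain_law K x0)" for m y n
  proof -
    have "{\<omega> \<in> space (chain_law K x0). (\<forall>i\<le>m. \<omega> i = y i) \<and> (\<forall>i. m < i \<and> i \<le> m + n \<longrightarrow> \<omega> i \<noteq> x)}
        \<in> sets (chain_law K x0)"
      by measurable
    then show ?thesis by (simp add: space_chain_law)
  qed
  have prod_upd: "(\<Prod>i<Suc m. pmf (K ((y(Suc m := z)) i)) ((y(Suc m := z)) (Suc i))) =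
      (\<Prod>i<m. pmf (K (y i)) (y (Suc i))) * pmf (K (y m)) z" for z
    unfolding prod.lessThan_Suc by (intro arg_cong2[where f = "(*)"] prod.cong) auto
  have cyl: "?P (?c (Suc m) (y(Suc m := z))) = ?P (?c m y) * ennreal (pmf (K (y m)) z)" for z
    unfolding emeasure_eq_measure chain_law_cylinder prod_upd
    by (simp add: ennreal_mult'' [symmetric])
  have "?P (?c m y) * ennreal (f (y m)) \<le> ?P (?c m y) * ennreal (measure_pmf.expectation (K (y m)) f)"
    using sub by (intro mult_left_mono ennreal_leI) auto
  also have "ennreal (measure_pmf.expectation (K (y m)) f) = (\<integral>\<^sup>+z. ennreal (f z) \<partial>K (y m))"
    using f01 by (intro nn_integral_eq_integral[symmetric] measure_pmf.integrable_const_bound[where B = 1]) auto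
  also have "\<dots> = (\<integral>\<^sup>+z. ennreal (pmf (K (y m)) z) * ennreal (f z) \<partial>count_space UNIV)"
    by (rule nn_integral_measure_pmf)
  also have "?P (?c m y) * \<dots> =
      (\<integral>\<^sup>+z. ?P (?c (Suc m) (y(Suc m := z))) * ennreal (f z) \<partial>count_space UNIV)"
    unfolding cyl by (simp add: nn_integral_cmult[symmetric] mult.assoc)
  \<comment> \<open>The term z = x vanishes because f x = 0; dropping it leaves exactly the
    continuations that avoid x at time m + 1.\<close>
  also have "\<dots> = (\<integral>\<^sup>+z. ?P (?c (Suc m) (y(Suc m := z))) * ennreal (f z) \<partial>count_space (- {x}))"
    by (subst (2) nn_integral_count_space_indicator, simp, intro nn_integral_cong) (auto simp: fx split: split_indicator)
  also have "\<dots> \<le> (\<integral>\<^sup>+z. ?P (?A (Suc m) (y(Suc m := z)) n) \<partial>count_space (- {x}))"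
    using Suc.IH[of "Suc m" "y(Suc m := z)" for z] by (intro nn_integral_mono) simp
  also have "\<dots> = ?P (\<Union>z\<in>- {x}. ?A (Suc m) (y(Suc m := z)) n)"
  proof (rule emeasure_UN_countable[symmetric])
    show "disjoint_family_on (\<lambda>z. ?A (Suc m) (y(Suc m := z)) n) (- {x})"
      unfolding disjoint_family_on_def by (auto dest!: spec[of _ "Suc m"])
  qed (rule sets_A, simp)
  also have "\<dots> \<le> ?P (?A m y (Suc n))"
  proof (intro emeasure_mono sets_A subsetI)
    fix \<omega> assume "\<omega> \<in> (\<Union>z\<in>- {x}. ?A (Suc m) (y(Suc m := z)) n)"
    then obtain z where z: "z \<noteq> x" "\<forall>i\<le>Suc m. \<omega> i = (y(Suc m := z)) i"
      and av: "\<forall>i. Suc m < i \<and> i \<le> Suc m + n \<longrightarrow> \<omega> i \<noteq> x" by auto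
    have "\<omega> i = y i" if "i \<le> m" for i
      using z(2) that by (auto dest: spec[of _ i])
    moreover have "\<omega> i \<noteq> x" if "m < i" "i \<le> m + Suc n" for i
      using z av that by (cases "i = Suc m") auto
    ultimately show "\<omega> \<in> ?A m y (Suc n)" by auto
  qed
  finally show ?case .
qed

text \<open>At x itself f is 0 and gives no information, so the chain first follows a path y from x
  that does not return and ends where f is positive. The probability of that path times f (y m)
  bounds the avoidance probability up to every finite time, and continuity from above passes to the
  limit.\<close>

lemma transient_state_if_bounded_submartingale:
  fixes K :: "'s :: countable \<Rightarrow> 's pmf" and f :: "'s \<Rightarrow> real"
  assumes f01: "\<And>z. 0 \<le> f z" "\<And>z. f z \<le> 1" and fx: "f x = 0"
    and sub: "\<And>z. f z \<le> measure_pmf.expectation (K z) f"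
    and y0: "y 0 = x" and avoid: "\<And>i. 1 \<le> i \<Longrightarrow> i \<le> m \<Longrightarrow> y i \<noteq> x"
    and path: "\<And>i. i < m \<Longrightarrow> y (Suc i) \<in> set_pmf (K (y i))"
    and pos: "f (y m) > 0"
  shows "transient_state K x"
proof -
  interpret prob_space "chain_law K x" by (rule prob_space_chain_law)
  have meas [measurable]: "(\<lambda>\<omega>. \<omega> i) \<in> measurable (chain_law K x) (count_space UNIV)" for i
    by (subst measurable_cong_sets[OF sets_chain_law refl]) simp
  define A where "A n = {\<omega> \<in> space (chain_law K x). \<forall>i. 1 \<le> i \<and> i \<le> m + n \<longrightarrow> \<omega> i \<noteq> x}" for n
  have sets_A: "A n \<in> events" for n
    unfolding A_def by measurable
  define \<delta> where "\<delta> = prob {\<omega>. \<forall>i\<le>m. \<omega> i = y i} * f (y m)"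
  have "prob {\<omega>. \<forall>i\<le>m. \<omega> i = y i} > 0"
    unfolding chain_law_cylinder using y0 path by (auto intro!: prod_pos simp: pmf_positive_iff)
  then have "\<delta> > 0"
    using pos by (simp add: \<delta>_def)
  have lower: "\<delta> \<le> prob (A n)" for n
  proof -
    have "ennreal \<delta> \<le> emeasure (chain_law K x)
        {\<omega>. (\<forall>i\<le>m. \<omega> i = y i) \<and> (\<forall>i. m < i \<and> i \<le> m + n \<longrightarrow> \<omega> i \<noteq> x)}"
      using emeasure_chain_law_avoid_ge[OF f01 fx sub, where m = m and n = n and y = y and ?x0.0 = x] f01
      by (simp add: \<delta>_def emeasure_eq_measure ennreal_mult)
    also have "\<dots> \<le> emeasure (chain_law K x) (A n)"
    proof (intro emeasure_mono sets_A subsetI)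
      fix \<omega> assume \<omega>: "\<omega> \<in> {\<omega>. (\<forall>i\<le>m. \<omega> i = y i) \<and> (\<forall>i. m < i \<and> i \<le> m + n \<longrightarrow> \<omega> i \<noteq> x)}"
      have "\<omega> i \<noteq> x" if "1 \<le> i" "i \<le> m + n" for i
        using \<omega> avoid[of i] that by (cases "i \<le> m") auto
      then show "\<omega> \<in> A n" by (simp add: A_def space_chain_law)
    qed
    finally show ?thesis
      by (simp add: emeasure_eq_measure)
  qed
  have "(\<lambda>n. prob (A n)) \<longlonglongrightarrow> prob (\<Inter>n. A n)"
    using sets_A by (intro finite_Lim_measure_decseq) (auto simp: A_def decseq_def)
  then have "\<delta> \<le> prob (\<Inter>n. A n)"
    by (rule LIMSEQ_le_const) (use lower in auto)
  moreover have "(\<Inter>n. A n) = {\<omega> \<in> space (chain_law K x). \<forall>n\<ge>1. \<omega> n \<noteq> x}"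
    by (auto simp: A_def) (metis le_add2)
  ultimately show ?thesis
    using \<open>\<delta> > 0\<close> by (simp add: transient_state_def)
qed

section \<open>The test weight and its use for the Hawkes kernel\<close>

text \<open>
  A Poisson variable \<open>L\<close> of rate \<open>s\<close> satisfies \<open>E[1 / (L + 1)] \<le> 1 / s\<close>, so the mean of this
  weight at \<open>L\<close> is at least its value at \<open>n\<close> whenever \<open>s \<ge> n + 1\<close>.
\<close>

definition escape_weight :: "real \<Rightarrow> nat \<Rightarrow> real" where
  "escape_weight C n = max 0 (1 - C / (real n + 1))"

lemma escape_weight_bounds:
  assumes "C \<ge> 0"
  shows "0 \<le> escape_weight C n" "escape_weight C n \<le> 1"
  using assms by (auto simp: escape_weight_def)

lemma escape_weight_pos_iff: "escape_weight C n > 0 \<longleftrightarrow> C < real n + 1"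
  by (auto simp: escape_weight_def less_max_iff_disj field_simps)

lemma hawkes_kernel_expectation:
  fixes f :: "nat \<times> nat \<times> nat \<Rightarrow> real"
  shows "measure_pmf.expectation (hawkes_kernel a b c lam (i, j, k)) f =
    (if a * i + b * j + c * k + lam \<le> 0 then f (0, i, j)
     else measure_pmf.expectation (poisson_pmf (a * i + b * j + c * k + lam)) (\<lambda>l. f (l, i, j)))"
  by (auto simp: hawkes_kernel_def hawkes_rate_def poisson_law_def max_def)

text \<open>Where f vanishes the submartingale inequality is trivial. The path (0, 0, 0), (i, 0, 0),
  (0, i, 0) has positive probability: lam > 0 makes the first rate positive, and 0 has positive mass
  under every Poisson law.\<close>

lemma hawkes_transient_if_submartingale:
  fixes f :: "nat \<times> nat \<times> nat \<Rightarrow> real"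
  assumes "lam > 0" and f01: "\<And>z. 0 \<le> f z" "\<And>z. f z \<le> 1" and "f (0, 0, 0) = 0"
    and sub: "\<And>i j k. f (i, j, k) > 0 \<Longrightarrow>
      f (i, j, k) \<le> measure_pmf.expectation (hawkes_kernel a b c lam (i, j, k)) f"
    and pos: "f (0, i, 0) > 0"
  shows "hawkes_transient a b c lam"
  unfolding hawkes_transient_def
proof (rule transient_state_if_bounded_submartingale
    [where f = f and m = 2 and y = "\<lambda>n. if n = 0 then (0, 0, 0) else if n = 1 then (i, 0, 0) else (0, i, 0)"])
  show "f z \<le> measure_pmf.expectation (hawkes_kernel a b c lam z) f" for z
  proof (cases "f z > 0")
    case False
    then show ?thesis
      using f01(1) by (metis Bochner_Integration.integral_nonneg order_trans not_less)
  qed (use sub in \<open>cases z; simp\<close>)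
  show "(if n = 0 then (0, 0, 0) else if n = 1 then (i, 0, 0) else (0, i, 0)) \<noteq> (0, 0, 0)"
    if "1 \<le> n" "n \<le> 2" for n :: nat
    using that pos \<open>f (0, 0, 0) = 0\<close> by (cases "i = 0") auto
  show "(if Suc n = 0 then (0, 0, 0) else if Suc n = 1 then (i, 0, 0) else (0, i, 0)) \<in>
      set_pmf (hawkes_kernel a b c lam (if n = 0 then (0, 0, 0) else if n = 1 then (i, 0, 0) else (0, i, 0)))"
    if "n < 2" for n
    using that \<open>lam > 0\<close> by (auto simp: less_2_cases_iff set_pmf_iff pmf_hawkes_kernel Let_def)
qed (use assms in auto)

section \<open>The two parameter regimes\<close>

text \<open>
  The chain started far out on an axis cycles \<open>(i, 0, 0) \<rightarrow> (0, i, 0) \<rightarrow> (0, 0, i) \<rightarrow> (l, 0, 0)\<close>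
  deterministically except for the last step, where \<open>l\<close> is about \<open>c i\<close>.
\<close>

lemma hawkes_transient_neg_neg:
  assumes "lam > 0" "a < 0" "b < 0" "c > 1"
  shows "hawkes_transient a b c lam"
proof -
  \<comment> \<open>The three entries of the maximum give the three inequalities of
    \<open>large\<close>: zero rate at (i, 0, 0), zero rate at (0, i, 0), and rate at least i + 1 at
    (0, 0, i).\<close>
  define C where "C = 1 + max (lam / (- a)) (max (lam / (- b)) (1 / (c - 1)))"
  have "C \<ge> 1"
    using assms by (simp add: C_def le_max_iff_disj)
  have large: "a * i + lam \<le> 0" "b * i + lam \<le> 0" "c * i + lam \<ge> i + 1"
    if "C < real i + 1" for i
  proof -
    have "lam / (- a) \<le> i" "lam / (- b) \<le> i" "1 / (c - 1) \<le> i"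
      using that by (auto simp: C_def)
    then show "a * i + lam \<le> 0" "b * i + lam \<le> 0" "c * i + lam \<ge> i + 1"
      using assms by (auto simp: field_simps)
  qed
  let ?g = "escape_weight C"
  \<comment> \<open>The two deterministic steps of the cycle preserve f, so only (0, 0, k) needs the
    Poisson estimate.\<close>
  define f where "f = (\<lambda>(i, j, k). if j = 0 \<and> k = 0 then ?g i else
     if i = 0 \<and> k = 0 then ?g j else if i = 0 \<and> j = 0 then ?g k else 0)"
  have g0: "?g 0 = 0"
    using \<open>C \<ge> 1\<close> by (simp add: escape_weight_def)
  have gb: "0 \<le> ?g n" "?g n \<le> 1" for n
    using escape_weight_bounds[of C n] \<open>C \<ge> 1\<close> by auto
  obtain i :: nat where i: "C < i"
    using reals_Archimedean2 by blast
  show ?thesis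
  proof (rule hawkes_transient_if_submartingale[where f = f and i = i])
    show "0 \<le> f z" "f z \<le> 1" for z
      using gb by (auto simp: f_def split: prod.splits)
    show "f (0, 0, 0) = 0"
      by (simp add: f_def g0)
    show "f (0, i, 0) > 0"
      using i by (auto simp: f_def escape_weight_pos_iff)
  next
    fix i j k assume pos: "f (i, j, k) > 0"
    then consider (x) "j = 0" "k = 0" "C < real i + 1" | (y) "i = 0" "k = 0" "C < real j + 1"
      | (z) "i = 0" "j = 0" "C < real k + 1"
      by (auto simp: f_def escape_weight_pos_iff split: if_splits)
    then show "f (i, j, k) \<le> measure_pmf.expectation (hawkes_kernel a b c lam (i, j, k)) f"
    proof cases
      case x
      then show ?thesis
        using large[of i] unfolding hawkes_kernel_expectation by (auto simp: f_def)
    next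
      case y
      then show ?thesis
        using large[of j] unfolding hawkes_kernel_expectation by (auto simp: f_def)
    next
      case z
      let ?s = "c * k + lam"
      have s: "?s \<ge> real k + 1" "?s > 0"
        using large(3)[of k] z by auto
      have "1 - C / (real k + 1) \<le> 1 - C / ?s"
        using s \<open>C \<ge> 1\<close> by (simp add: divide_left_mono)
      also have "\<dots> \<le> measure_pmf.expectation (poisson_pmf ?s) ?g"
        using poisson_pmf_expectation_ge[of ?s C 0 ?g] s gb \<open>C \<ge> 1\<close>
        by (auto simp: escape_weight_def)
      finally have "?g k \<le> measure_pmf.expectation (poisson_pmf ?s) ?g"
        using z by (simp add: escape_weight_def field_simps)
      then show ?thesis
        using z s g0 unfolding hawkes_kernel_expectation by (auto simp: f_def)
    qed
  qed (fact assms)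
qed

text \<open>
  Here the cycle is \<open>(0, i, 0) \<rightarrow> (l, 0, i) \<rightarrow> (0, l, 0)\<close> with \<open>l\<close> about \<open>b i\<close>. The second step
  is deterministic as soon as \<open>a l + c i + lam \<le> 0\<close>; by Chebyshev's inequality this fails with
  probability \<open>O(1/i)\<close>, which a large \<open>C\<close> absorbs.
\<close>

lemma hawkes_transient_alternating:
  assumes "lam > 0" "b > 1" "a * b + c < 0"
  shows "hawkes_transient a b c lam"
proof -
  define d where "d = - (a * b + c)"
  have "d > 0" using assms by (simp add: d_def)
  \<comment> \<open>K/i bounds the Chebyshev probability a^2 s / D^2 that the cycle breaks, by s
    \<le> (b + lam) i and D \<ge> d i / 2.\<close>
  define K where "K = 4 * a\<^sup>2 * (b + lam) / d\<^sup>2"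
  \<comment> \<open>In turn, the entries ensure D \<ge> d i / 2, s - (i + 1) \<ge> (b - 1) i / 2,
    and that the gain C/(i + 1) - C/s is at least K/i. There is no circularity, since K does not
    involve C.\<close>
  define C where "C = 2 + max (2 * \<bar>(a + 1) * lam\<bar> / d)
      (max (2 / (b - 1)) (4 * K * (b + lam) / (b - 1)))"
  have "C \<ge> 2"
    using assms by (simp add: C_def le_max_iff_disj)
  let ?g = "escape_weight C"
  \<comment> \<open>Here s is the rate at (0, i, 0), and -D is the untruncated rate that would
    follow if the Poisson value l were equal to its mean s.\<close>
  have drift: "C / s + a\<^sup>2 / D\<^sup>2 * s \<le> C / (real i + 1)" "D > 0"
    if i: "C < real i + 1" and s: "s = b * real i + lam" and D: "D = - (a * s + c * i + lam)"
    for i :: nat and s D :: real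
  proof -
    have i1: "real i \<ge> 1" using i \<open>C \<ge> 2\<close> by simp
    have "2 * \<bar>(a + 1) * lam\<bar> / d \<le> i" "2 / (b - 1) \<le> i"
      using i by (auto simp: C_def)
    then have d2: "2 * \<bar>(a + 1) * lam\<bar> \<le> d * i" and b2: "2 \<le> (b - 1) * i"
      using \<open>d > 0\<close> \<open>b > 1\<close> by (auto simp: field_simps)
    have "D = d * i - (a + 1) * lam"
      by (simp add: D s d_def algebra_simps)
    then have D2: "D \<ge> d * i / 2" using d2 by (auto simp: abs_if split: if_splits)
    moreover have di: "d * i / 2 > 0" using \<open>d > 0\<close> i1 by simp
    ultimately show "D > 0" by linarith
    have s1: "s \<le> (b + lam) * i" "s > 0"
      using i1 assms by (auto simp: s algebra_simps intro: add_pos_pos)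
    have "0 < D\<^sup>2 * (d * i / 2)\<^sup>2"
      using \<open>D > 0\<close> di by (intro mult_pos_pos zero_less_power)
    then have "a\<^sup>2 / D\<^sup>2 * s \<le> a\<^sup>2 / (d * i / 2)\<^sup>2 * ((b + lam) * i)"
      using D2 di s1 by (intro mult_mono divide_left_mono power_mono) auto
    also have "\<dots> = K / i"
      using i1 \<open>d > 0\<close> by (simp add: K_def field_simps power2_eq_square)
    finally have 1: "a\<^sup>2 / D\<^sup>2 * s \<le> K / i" .
    have "4 * K * (b + lam) / (b - 1) \<le> C"
      by (simp add: C_def)
    then have "K \<le> C * (b - 1) / (4 * (b + lam))"
      using assms by (simp add: field_simps)
    then have "K / i \<le> C * (b - 1) / (4 * (b + lam)) / i"
      using i1 by (intro divide_right_mono) auto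
    also have "\<dots> = C * ((b - 1) * i / 2) / ((2 * i) * ((b + lam) * i))"
    proof -
      have "C * u / (4 * v) / i = C * (u * i / 2) / ((2 * i) * (v * i))" if "v > 0" for u v :: real
        using i1 that by (simp add: field_simps)
      then show ?thesis using assms by simp
    qed
    also have "\<dots> \<le> C * (s - (real i + 1)) / ((real i + 1) * s)"
    proof (rule frac_le)
      have "(b - 1) * i / 2 \<le> s - (real i + 1)"
        using b2 assms(1) by (simp add: s field_simps)
      then show "C * ((b - 1) * i / 2) \<le> C * (s - (real i + 1))"
        using \<open>C \<ge> 2\<close> by (intro mult_left_mono) auto
      then show "0 \<le> C * (s - (real i + 1))"
        using \<open>C \<ge> 2\<close> b2 by (meson order_trans mult_nonneg_nonneg divide_nonneg_nonneg zero_le_numeral)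
      show "0 < (real i + 1) * s" using s1 by simp
      show "(real i + 1) * s \<le> 2 * i * ((b + lam) * i)"
        using i1 s1 by (intro mult_mono) auto
    qed
    also have "\<dots> = C / (real i + 1) - C / s"
      using s1 by (simp add: field_simps)
    finally show "C / s + a\<^sup>2 / D\<^sup>2 * s \<le> C / (real i + 1)"
      using 1 by linarith
  qed
  \<comment> \<open>The second branch covers states (i, 0, k) of rate 0: they move surely to (0, i,
    0), where f has the same value.\<close>
  define f where "f = (\<lambda>(i, j, k). if i = 0 \<and> k = 0 then ?g j else
     if j = 0 \<and> a * real i + c * real k + lam \<le> 0 then ?g i else 0)"
  have g0: "?g 0 = 0"
    using \<open>C \<ge> 2\<close> by (simp add: escape_weight_def)
  have gb: "0 \<le> ?g n" "?g n \<le> 1" for n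
    using escape_weight_bounds[of C n] \<open>C \<ge> 2\<close> by auto
  obtain i :: nat where i: "C < i"
    using reals_Archimedean2 by blast
  show ?thesis
  proof (rule hawkes_transient_if_submartingale[where f = f and i = i])
    show f01: "0 \<le> f z" "f z \<le> 1" for z
      using gb by (auto simp: f_def split: prod.splits)
    show "f (0, 0, 0) = 0"
      by (simp add: f_def g0)
    show "f (0, i, 0) > 0"
      using i by (auto simp: f_def escape_weight_pos_iff)
    fix i j k assume pos: "f (i, j, k) > 0"
    then consider (y) "i = 0" "k = 0" "C < real j + 1"
      | (x) "j = 0" "a * real i + c * real k + lam \<le> 0"
      by (auto simp: f_def escape_weight_pos_iff split: if_splits)
    then show "f (i, j, k) \<le> measure_pmf.expectation (hawkes_kernel a b c lam (i, j, k)) f"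
    proof cases
      case x
      then show ?thesis
        using gb g0 unfolding hawkes_kernel_expectation by (auto simp: f_def)
    next
      case y
      define s where "s = b * real j + lam"
      define D where "D = - (a * s + c * j + lam)"
      note drift = drift[OF y(3) s_def D_def]
      have "s > 0" using assms by (simp add: s_def add_nonneg_pos)
      have j: "j \<noteq> 0" using y \<open>C \<ge> 2\<close> by auto
      have "1 - C / (real j + 1) \<le> 1 - C / s - a\<^sup>2 / D\<^sup>2 * s"
        using drift by simp
      also have "\<dots> \<le> measure_pmf.expectation (poisson_pmf s) (\<lambda>l. f (l, 0, j))"
      proof (rule poisson_pmf_expectation_ge)
        fix l
        show "1 - C / (real l + 1) - a\<^sup>2 / D\<^sup>2 * (real l - s)\<^sup>2 \<le> f (l, 0, j)"
        proof (cases "a * real l + c * real j + lam \<le> 0")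
          case True
          have "1 - C / (real l + 1) \<le> f (l, 0, j)"
            using True j by (simp add: f_def escape_weight_def)
          moreover have "0 \<le> a\<^sup>2 / D\<^sup>2 * (real l - s)\<^sup>2" by simp
          ultimately show ?thesis by linarith
        next
          case False
          \<comment> \<open>The cycle breaks only if a (l - s) exceeds D > 0; then the quadratic
            penalty is at least 1 and the claimed lower bound is at most 0.\<close>
          then have "a * (real l - s) \<ge> D"
            by (simp add: D_def algebra_simps)
          then have "(a * (real l - s))\<^sup>2 \<ge> D\<^sup>2"
            using drift by (intro power_mono) auto
          then have "1 \<le> a\<^sup>2 * (real l - s)\<^sup>2 / D\<^sup>2"
            using drift(2) by (simp only: power_mult_distrib le_divide_eq_1_pos zero_less_power)
          then have "1 \<le> a\<^sup>2 / D\<^sup>2 * (real l - s)\<^sup>2"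
            by simp
          moreover have "C / (real l + 1) \<ge> 0" using \<open>C \<ge> 2\<close> by simp
          ultimately show ?thesis using f01(1)[of "(l, 0, j)"] by linarith
        qed
      qed (use \<open>s > 0\<close> \<open>C \<ge> 2\<close> f01 in auto)
      finally have "?g j \<le> measure_pmf.expectation (poisson_pmf s) (\<lambda>l. f (l, 0, j))"
        using y by (simp add: escape_weight_def field_simps)
      then show ?thesis
        using y \<open>s > 0\<close> unfolding hawkes_kernel_expectation by (auto simp: f_def s_def)
    qed
  qed (fact assms)
qed

theorem proposition2p4:
  fixes a b c lam :: real
  assumes "lam > 0"
    and "(a < 0 \<and> b < 0 \<and> c > 1) \<or> (b > 1 \<and> a * b + c < 0)"
  shows "hawkes_transient a b c lam"
  using assms hawkes_transient_neg_neg hawkes_transient_alternating by blast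

end
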